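(* Let $N>1$, $p_{10},p_{01}\in(0,1)$ with $p_{10}+p_{01}<1$, and let $\mathbf{\Lambda}_s$ be the rate region of the saturated $N$-queue system with one-slot switchover delay and Gilbert-Elliot channels with transition probabilities $p_{10},p_{01}$. With $C_0^{(N)}=\frac{p_{10}^N}{(p_{10}+p_{01})^N}$, every $(r_1,\dots,r_N)\in\mathbf{\Lambda}_s$ satisfies $$\sum_{i=1}^N r_i\le 1-C_0^{(N)}-\Big(p_{10}\big(1-C_0^{(N)}\big)-p_{01}C_0^{(N)}\Big).$$
   Context: Saturated system (all queues always nonempty): a Markov decision process with state $\mathbf{s}_t=(m(t),C_1(t),\dots,C_N(t))\in\mathcal S=\{1,\dots,N\}\times\{0,1\}^N$, where $m(t)$ is the queue at which the server is located in slot $t$ and $C_i(t)$ is the channel state of queue $i$ ($1$ = ON, $0$ = OFF). The $C_i$ are independent, identically parametrized two-state Markov chains, unaffected by the actions, with transition probability $p_{10}$ from ON to OFF and $p_{01}$ from OFF to ON. The action $a_t\in\mathcal A=\{1,\dots,N\}$ is the queue at which the server will be present in the next slot: $m(t+1)=a_t$. The reward functions are $\overline r_i(\mathbf{s},a)=1$ if $m=i$, $C_i=1$ and $a=i$, and $0$ otherwise. Let $\mathbf{P}(\mathbf{s}|\mathbf{s}',a)$ be the transition probabilities, and let $\mathbf{X}$ be the polytope of vectors $\mathbf{x}\ge0$ indexed by $\mathcal S\times\mathcal A$ with $\sum_{\mathbf{s},a}\mathbf{x}(\mathbf{s},a)=1$ and $\sum_a\mathbf{x}(\mathbf{s},a)=\sum_{\mathbf{s}'}\sum_a\mathbf{P}(\mathbf{s}|\mathbf{s}',a)\mathbf{x}(\mathbf{s}',a)$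 for all $\mathbf{s}\in\mathcal S$. The rate region is $\mathbf{\Lambda}_s=\{\mathbf{r}\in\mathbb{R}^N: r_i=\sum_{\mathbf{s},a}\mathbf{x}(\mathbf{s},a)\overline r_i(\mathbf{s},a)\ \forall i,\ \mathbf{x}\in\mathbf{X}\}$, which is the set of all time average expected departure rate vectors obtainable in the saturated system. $C_0^{(N)}$ is the steady state probability that all channels are OFF. *)

theory Defs
  imports "HOL-Analysis.Analysis"
begin

text \<open>
  Queues are the elements of a finite type \<open>'n\<close>, so the number of queues is \<open>CARD('n)\<close>.
  A state \<open>(m, C)\<close> consists of the server location \<open>m\<close> and the channel states \<open>C\<close>,
  where \<open>C i\<close> holds iff channel \<open>i\<close> is ON. An action is the queue at which the server
  will be present in the next slot.
\<close>

type_synonym 'n state = "'n \<times> ('n \<Rightarrow> bool)"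

definition channel_trans :: "real \<Rightarrow> real \<Rightarrow> bool \<Rightarrow> bool \<Rightarrow> real" where
  "channel_trans p10 p01 c c' =
     (if c then (if c' then 1 - p10 else p10)
           else (if c' then p01 else 1 - p01))"

text \<open>
  \<open>trans_prob p10 p01 s' a s\<close> is the probability of moving from \<open>s'\<close> to \<open>s\<close> under action
  \<open>a\<close>, i.e. \<open>P(s | s', a)\<close>: the server moves to \<open>a\<close> and the channels evolve independently
  of each other and of the action.
\<close>

definition trans_prob :: "real \<Rightarrow> real \<Rightarrow> 'n::finite state \<Rightarrow> 'n \<Rightarrow> 'n state \<Rightarrow> real" where
  "trans_prob p10 p01 s' a s =
     (if fst s = a then \<Prod>i\<in>UNIV. channel_trans p10 p01 (snd s' i) (snd s i) else 0)"

definition reward :: "'n \<Rightarrow> 'n state \<Rightarrow> 'n \<Rightarrow> real" where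
  "reward i s a = (if fst s = i \<and> snd s i \<and> a = i then 1 else 0)"

definition state_action_polytope :: "real \<Rightarrow> real \<Rightarrow> ('n::finite state \<Rightarrow> 'n \<Rightarrow> real) set" where
  "state_action_polytope p10 p01 =
     {x. (\<forall>s a. 0 \<le> x s a) \<and>
         (\<Sum>s\<in>UNIV. \<Sum>a\<in>UNIV. x s a) = 1 \<and>
         (\<forall>s. (\<Sum>a\<in>UNIV. x s a) =
              (\<Sum>s'\<in>UNIV. \<Sum>a\<in>UNIV. trans_prob p10 p01 s' a s * x s' a))}"

definition rate_region :: "real \<Rightarrow> real \<Rightarrow> (real ^ 'n::finite) set" where
  "rate_region p10 p01 =
     {r. \<exists>x \<in> state_action_polytope p10 p01.
           \<forall>i. r $ i = (\<Sum>s\<in>UNIV. \<Sum>a\<in>UNIV. x s a * reward i s a)}"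

end

theory Submission
  imports Defs
begin

text \<open>
  A reward in the next slot requires that the channel of the queue selected now be ON in the
  next slot. Given the current channel states, that happens with probability at most
  \<open>1 - p10\<close> if some channel is ON and exactly \<open>p01\<close> if all are OFF, because
  \<open>p01 < 1 - p10\<close>. Since a point of the polytope is a stationary state-action distribution, the
  total reward is therefore at most \<open>(1 - p10) (1 - q) + p01 q\<close>, where \<open>q\<close> is its mass on the
  states with all channels OFF; this is the bound of the theorem once \<open>q = C0\<close>
  (\<open>mass_all_off\<close>).

  The channels ignore the actions, so \<open>q\<close> is the all-OFF probability in a stationary distribution
  of the product of the channel chains, which has to be shown unique at this event. Let
  \<open>\<theta> = p10 / (p10 + p01)\<close> be the OFF probability of a single stationary channel. The centred
  indicator \<open>[C i = OFF] - \<theta>\<close> is an eigenfunction of the one-channel chain for the eigenvalue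
  \<open>1 - p10 - p01\<close>, which lies strictly between 0 and 1. By independence, the product of
  these functions over a set \<open>A\<close> of queues is an eigenfunction for
  \<open>(1 - p10 - p01) ^ card A\<close>, so its stationary mean vanishes unless \<open>A\<close> is empty
  (\<open>mean_centred_off_eq_0\<close>). Expanding \<open>\<Prod>i. (([C i = OFF] - \<theta>) + \<theta>)\<close> over subsets leaves
  only the term of the empty set, \<open>\<theta> ^ N = C0\<close>.
\<close>

lemma sum_prod_bool_fun:
  fixes f :: "'n::finite \<Rightarrow> bool \<Rightarrow> 'a::comm_semiring_1"
  shows "(\<Sum>C\<in>UNIV. \<Prod>i\<in>UNIV. f i (C i)) = (\<Prod>i\<in>UNIV. f i True + f i False)"
proof -
  have "(\<Prod>i\<in>UNIV. f i True + f i False) = (\<Prod>i\<in>UNIV. \<Sum>c\<in>(UNIV::bool set). f i c)"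
    by (simp add: UNIV_bool add.commute)
  also have "\<dots> = (\<Sum>C\<in>PiE UNIV (\<lambda>_. UNIV). \<Prod>i\<in>UNIV. f i (C i))"
    by (rule prod_sum_PiE) auto
  finally show ?thesis by simp
qed

lemma sum_trans_prob:
  fixes F :: "'n::finite state \<Rightarrow> real"
  shows "(\<Sum>s\<in>UNIV. trans_prob p10 p01 s' a s * F s) =
    (\<Sum>C\<in>UNIV. (\<Prod>i\<in>UNIV. channel_trans p10 p01 (snd s' i) (C i)) * F (a, C))"
proof -
  have "(\<Sum>s\<in>UNIV. trans_prob p10 p01 s' a s * F s) =
    (\<Sum>m\<in>UNIV. \<Sum>C\<in>UNIV. trans_prob p10 p01 s' a (m, C) * F (m, C))"
    by (simp add: sum.cartesian_product)
  also have "\<dots> = (\<Sum>m\<in>UNIV. if m = a then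
      \<Sum>C\<in>UNIV. (\<Prod>i\<in>UNIV. channel_trans p10 p01 (snd s' i) (C i)) * F (m, C) else 0)"
    by (intro sum.cong) (auto simp: trans_prob_def)
  finally show ?thesis by simp
qed

text \<open>Independence of the channels: conditional means of product functions factorize.\<close>

lemma sum_trans_prob_prod:
  fixes g :: "'n::finite \<Rightarrow> bool \<Rightarrow> real"
  shows "(\<Sum>s\<in>UNIV. trans_prob p10 p01 s' a s * (\<Prod>i\<in>UNIV. g i (snd s i))) =
    (\<Prod>i\<in>UNIV. channel_trans p10 p01 (snd s' i) True * g i True
             + channel_trans p10 p01 (snd s' i) False * g i False)"
  unfolding sum_trans_prob
  using sum_prod_bool_fun[of "\<lambda>i c. channel_trans p10 p01 (snd s' i) c * g i c"]
  by (simp add: prod.distrib)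

text \<open>
  The server moves to \<open>a\<close>, so the indicator of the event is a product function whose only
  nonconstant factor is the one of channel \<open>a\<close>; every other factor has conditional mean 1.
\<close>

lemma prob_selected_on:
  fixes s' :: "'n::finite state"
  shows "(\<Sum>s\<in>UNIV. trans_prob p10 p01 s' a s * of_bool (snd s (fst s))) =
    channel_trans p10 p01 (snd s' a) True"
proof -
  have "(\<Sum>s\<in>UNIV. trans_prob p10 p01 s' a s * of_bool (snd s (fst s))) =
    (\<Sum>s\<in>UNIV. trans_prob p10 p01 s' a s * (\<Prod>i\<in>UNIV. of_bool (i = a \<longrightarrow> snd s i)))"
    by (intro sum.cong refl) (auto simp: trans_prob_def)
  also have "\<dots> = (\<Prod>i\<in>UNIV. channel_trans p10 p01 (snd s' i) True * of_bool (i = a \<longrightarrow> True)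
             + channel_trans p10 p01 (snd s' i) False * of_bool (i = a \<longrightarrow> False))"
    by (rule sum_trans_prob_prod)
  also have "\<dots> = (\<Prod>i\<in>UNIV. if i = a then channel_trans p10 p01 (snd s' i) True else 1)"
    by (intro prod.cong) (auto simp: channel_trans_def)
  finally show ?thesis by simp
qed

text \<open>The balance equations say that the state distribution is reproduced by one transition; pairing them
  with \<open>F\<close> moves that transition onto \<open>F\<close>, where its effect can be computed.\<close>

lemma polytope_stationary_mean:
  fixes x :: "'n::finite state \<Rightarrow> 'n \<Rightarrow> real"
  assumes "x \<in> state_action_polytope p10 p01"
  shows "(\<Sum>s\<in>UNIV. \<Sum>a\<in>UNIV. x s a * F s) =
    (\<Sum>s'\<in>UNIV. \<Sum>a\<in>UNIV. x s' a * (\<Sum>s\<in>UNIV. trans_prob p10 p01 s' a s * F s))"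
proof -
  have balance: "(\<Sum>a\<in>UNIV. x s a) = (\<Sum>s'\<in>UNIV. \<Sum>a\<in>UNIV. trans_prob p10 p01 s' a s * x s' a)" for s
    using assms unfolding state_action_polytope_def by blast
  have "(\<Sum>s\<in>UNIV. \<Sum>a\<in>UNIV. x s a * F s) = (\<Sum>s\<in>UNIV. (\<Sum>a\<in>UNIV. x s a) * F s)"
    by (simp add: sum_distrib_right)
  also have "\<dots> = (\<Sum>s\<in>UNIV. (\<Sum>s'\<in>UNIV. \<Sum>a\<in>UNIV. trans_prob p10 p01 s' a s * x s' a) * F s)"
    by (simp only: balance)
  also have "\<dots> = (\<Sum>s\<in>UNIV. \<Sum>s'\<in>UNIV. \<Sum>a\<in>UNIV. x s' a * (trans_prob p10 p01 s' a s * F s))"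
    by (simp only: sum_distrib_right) (simp only: mult_ac)
  also have "\<dots> = (\<Sum>s'\<in>UNIV. \<Sum>s\<in>UNIV. \<Sum>a\<in>UNIV. x s' a * (trans_prob p10 p01 s' a s * F s))"
    by (rule sum.swap)
  also have "\<dots> = (\<Sum>s'\<in>UNIV. \<Sum>a\<in>UNIV. \<Sum>s\<in>UNIV. x s' a * (trans_prob p10 p01 s' a s * F s))"
    by (intro sum.cong refl sum.swap)
  finally show ?thesis by (simp add: sum_distrib_left)
qed

text \<open>
  An eigenfunction of the transition operator for an eigenvalue other than 1 has stationary mean 0.
  The assumption \<open>p10 + p01 < 1\<close> keeps every positive power of \<open>1 - p10 - p01\<close> away from 1.
\<close>

lemma mean_centred_off_eq_0:
  fixes x :: "'n::finite state \<Rightarrow> 'n \<Rightarrow> real" and A :: "'n set"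
  assumes x: "x \<in> state_action_polytope p10 p01"
    and p: "0 < p10" "0 < p01" "p10 + p01 < 1"
    and "A \<noteq> {}"
  defines "\<theta> \<equiv> p10 / (p10 + p01)"
  shows "(\<Sum>s\<in>UNIV. \<Sum>a\<in>UNIV. x s a * (\<Prod>i\<in>A. of_bool (\<not> snd s i) - \<theta>)) = 0"
    (is "?E = 0")
proof -
  define \<mu> where "\<mu> = 1 - p10 - p01"
  define g where "g = (\<lambda>i c. if i \<in> A then of_bool (\<not> c) - \<theta> else 1 :: real)"
  have prod_g: "(\<Prod>i\<in>A. of_bool (\<not> C i) - \<theta>) = (\<Prod>i\<in>UNIV. g i (C i))" for C :: "'n \<Rightarrow> bool"
    by (simp add: g_def prod.If_cases)
  have \<theta>: "p10 = \<theta> * (p10 + p01)"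
    using p by (simp add: \<theta>_def)
  have one_channel: "channel_trans p10 p01 c True * g i True + channel_trans p10 p01 c False * g i False
      = (if i \<in> A then \<mu> else 1) * g i c" for i c
    using \<theta> by (auto simp: channel_trans_def g_def \<mu>_def algebra_simps)
  have "(\<Sum>s\<in>UNIV. trans_prob p10 p01 s' a s * (\<Prod>i\<in>UNIV. g i (snd s i)))
      = \<mu> ^ card A * (\<Prod>i\<in>UNIV. g i (snd s' i))" for s' :: "'n state" and a
    by (simp add: sum_trans_prob_prod one_channel prod.distrib prod.If_cases)
  then have "?E = \<mu> ^ card A * ?E"
    unfolding prod_g
    by (subst polytope_stationary_mean[OF x]) (simp add: sum_distrib_left mult_ac)
  moreover have "\<mu> ^ card A < 1"
    using p \<open>A \<noteq> {}\<close> by (subst power_less_one_iff) (auto simp: \<mu>_def card_gt_0_iff)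
  ultimately show ?thesis by simp
qed

lemma mass_all_off:
  fixes x :: "'n::finite state \<Rightarrow> 'n \<Rightarrow> real"
  assumes x: "x \<in> state_action_polytope p10 p01"
    and p: "0 < p10" "0 < p01" "p10 + p01 < 1"
  shows "(\<Sum>s\<in>UNIV. \<Sum>a\<in>UNIV. x s a * of_bool (\<forall>i. \<not> snd s i)) =
    (p10 / (p10 + p01)) ^ CARD('n)"
proof -
  define \<theta> where "\<theta> = p10 / (p10 + p01)"
  define f where "f = (\<lambda>A (s::'n state). \<Prod>i\<in>A. of_bool (\<not> snd s i) - \<theta>)"
  have expand: "of_bool (\<forall>i. \<not> snd s i) = (\<Sum>A\<in>Pow UNIV. f A s * \<theta> ^ card (UNIV - A))"
    for s :: "'n state"
  proof -
    have "of_bool (\<forall>i. \<not> snd s i) = (\<Prod>i\<in>UNIV. (of_bool (\<not> snd s i) - \<theta>) + \<theta>)"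
      by simp
    also have "\<dots> = (\<Sum>A\<in>Pow UNIV. f A s * \<theta> ^ card (UNIV - A))"
      unfolding f_def by (subst prod_add) simp_all
    finally show ?thesis .
  qed
  have mean: "(\<Sum>s\<in>UNIV. \<Sum>a\<in>UNIV. x s a * f A s) = of_bool (A = {})" for A
  proof (cases "A = {}")
    case True
    then show ?thesis using x by (simp add: f_def state_action_polytope_def)
  next
    case False
    then show ?thesis
      using mean_centred_off_eq_0[OF x p False] by (simp add: f_def \<theta>_def)
  qed
  have "(\<Sum>s\<in>UNIV. \<Sum>a\<in>UNIV. x s a * of_bool (\<forall>i. \<not> snd s i)) =
      (\<Sum>s\<in>UNIV. \<Sum>a\<in>UNIV. \<Sum>A\<in>Pow UNIV. x s a * f A s * \<theta> ^ card (UNIV - A))"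
    by (simp only: expand sum_distrib_left mult.assoc)
  also have "\<dots> = (\<Sum>s\<in>UNIV. \<Sum>A\<in>Pow UNIV. \<Sum>a\<in>UNIV. x s a * f A s * \<theta> ^ card (UNIV - A))"
    by (intro sum.cong refl sum.swap)
  also have "\<dots> = (\<Sum>A\<in>Pow UNIV. \<Sum>s\<in>UNIV. \<Sum>a\<in>UNIV. x s a * f A s * \<theta> ^ card (UNIV - A))"
    by (rule sum.swap)
  also have "\<dots> = (\<Sum>A\<in>Pow (UNIV :: 'n set). of_bool (A = {}) * \<theta> ^ card (UNIV - A))"
    by (simp only: mean[symmetric] sum_distrib_right)
  also have "\<dots> = (\<Sum>A\<in>(UNIV :: 'n set set). if A = {} then \<theta> ^ CARD('n) else 0)"
    by (intro sum.cong) auto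
  finally show ?thesis by (simp add: \<theta>_def)
qed

theorem lemma3:
  fixes p10 p01 C0 :: real and r :: "real ^ 'n::finite"
  assumes "CARD('n) > 1"
    and "0 < p10" "p10 < 1" "0 < p01" "p01 < 1"
    and "p10 + p01 < 1"
    and "C0 = p10 ^ CARD('n) / (p10 + p01) ^ CARD('n)"
    and "r \<in> rate_region p10 p01"
  shows "(\<Sum>i\<in>UNIV. r $ i) \<le> 1 - C0 - (p10 * (1 - C0) - p01 * C0)"
proof -
  from assms(8) obtain x :: "'n state \<Rightarrow> 'n \<Rightarrow> real"
    where x: "x \<in> state_action_polytope p10 p01"
      and r: "\<And>i. r $ i = (\<Sum>s\<in>UNIV. \<Sum>a\<in>UNIV. x s a * reward i s a)"
    by (auto simp: rate_region_def)
  from x have nonneg: "0 \<le> x s a" and total: "(\<Sum>s\<in>UNIV. \<Sum>a\<in>UNIV. x s a) = 1" for s a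
    unfolding state_action_polytope_def by blast+
  let ?off = "\<lambda>s :: 'n state. of_bool (\<forall>i. \<not> snd s i) :: real"
  have mass: "(\<Sum>s\<in>UNIV. \<Sum>a\<in>UNIV. x s a * ?off s) = C0"
    using mass_all_off[OF x] assms by (simp add: power_divide)
  have reward_le: "(\<Sum>i\<in>UNIV. reward i s a) \<le> of_bool (snd s (fst s))" for s :: "'n state" and a
  proof -
    have "(\<Sum>i\<in>UNIV. reward i s a) \<le> (\<Sum>i\<in>UNIV. if i = fst s then of_bool (snd s (fst s)) else 0)"
      by (intro sum_mono) (auto simp: reward_def)
    then show ?thesis by simp
  qed
  have "(\<Sum>i\<in>UNIV. r $ i) = (\<Sum>s\<in>UNIV. \<Sum>i\<in>UNIV. \<Sum>a\<in>UNIV. x s a * reward i s a)"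
    unfolding r by (rule sum.swap)
  also have "\<dots> = (\<Sum>s\<in>UNIV. \<Sum>a\<in>UNIV. \<Sum>i\<in>UNIV. x s a * reward i s a)"
    by (intro sum.cong refl sum.swap)
  also have "\<dots> = (\<Sum>s\<in>UNIV. \<Sum>a\<in>UNIV. x s a * (\<Sum>i\<in>UNIV. reward i s a))"
    by (simp add: sum_distrib_left)
  also have "\<dots> \<le> (\<Sum>s\<in>UNIV. \<Sum>a\<in>UNIV. x s a * of_bool (snd s (fst s)))"
    by (intro sum_mono mult_left_mono reward_le nonneg)
  also have "\<dots> = (\<Sum>s\<in>UNIV. \<Sum>a\<in>UNIV. x s a * channel_trans p10 p01 (snd s a) True)"
    unfolding polytope_stationary_mean[OF x] prob_selected_on ..
  \<comment> \<open>The all-OFF states lower the success probability from \<open>1 - p10\<close> to \<open>p01\<close>.\<close>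
  also have "\<dots> \<le> (\<Sum>s\<in>UNIV. \<Sum>a\<in>UNIV. x s a * ((1 - p10) - (1 - p10 - p01) * ?off s))"
    using assms by (intro sum_mono mult_left_mono nonneg) (auto simp: channel_trans_def)
  also have "\<dots> = (1 - p10) * (\<Sum>s\<in>UNIV. \<Sum>a\<in>UNIV. x s a)
      - (1 - p10 - p01) * (\<Sum>s\<in>UNIV. \<Sum>a\<in>UNIV. x s a * ?off s)"
    by (simp only: right_diff_distrib sum_subtractf sum_distrib_left mult.left_commute mult.commute)
  also have "\<dots> = 1 - C0 - (p10 * (1 - C0) - p01 * C0)"
    unfolding mass total by (simp add: algebra_simps)
  finally show ?thesis .
qed

end
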